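(* Every set $E\subset\mathbb{R}^2$ of four points having rational coordinates has the weighted discrete Pompeiu property with respect to the group of isometries of $\mathbb{R}^2$.
   Context: Let $\mathcal{G}$ be a family of bijections of a set $X$ onto itself. An $n$-tuple $(x_1,\dots,x_n)$ of points of $X$ has the weighted discrete Pompeiu property with respect to $\mathcal{G}$ if the following holds: whenever $\alpha_1,\dots,\alpha_n$ are complex numbers with $\sum_{i=1}^n\alpha_i\neq 0$ and $f\colon X\to\mathbb{C}$ is a function (no regularity assumed) such that $\sum_{j=1}^n\alpha_j f(\phi(x_j))=0$ for every $\phi\in\mathcal{G}$, then $f\equiv 0$. For a set of $n$ distinct points, the property refers to the $n$-tuple obtained by enumerating its points (the order is irrelevant). *)

theory Defs
  imports "HOL-Analysis.Analysis"
begin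

(* The ambient set X is the whole type 'a, and G is a family of bijections of it.
   An n-tuple is a list of length n; repeated points are allowed. *)
definition weighted_pompeiu_tuple :: "('a \<Rightarrow> 'a) set \<Rightarrow> 'a list \<Rightarrow> bool" where
  "weighted_pompeiu_tuple G xs \<longleftrightarrow>
     (\<forall>(\<alpha> :: nat \<Rightarrow> complex) (f :: 'a \<Rightarrow> complex).
        (\<Sum>j<length xs. \<alpha> j) \<noteq> 0 \<longrightarrow>
        (\<forall>\<phi>\<in>G. (\<Sum>j<length xs. \<alpha> j * f (\<phi> (xs ! j))) = 0) \<longrightarrow>
        (\<forall>x. f x = 0))"

(* The order of enumeration is irrelevant, so all enumerations are required to have the property;
   the finiteness conjunct keeps the quantifier over enumerations from being vacuous. *)
definition weighted_pompeiu_set :: "('a \<Rightarrow> 'a) set \<Rightarrow> 'a set \<Rightarrow> bool" where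
  "weighted_pompeiu_set G E \<longleftrightarrow>
     finite E \<and> (\<forall>xs. distinct xs \<and> set xs = E \<longrightarrow> weighted_pompeiu_tuple G xs)"

definition isometries :: "('a::metric_space \<Rightarrow> 'a) set" where
  "isometries = {\<phi>. bij \<phi> \<and> (\<forall>x y. dist (\<phi> x) (\<phi> y) = dist x y)}"

end

theory Submission
  imports Defs "HOL-Computational_Algebra.Fundamental_Theorem_Algebra"
begin

text \<open>
  Identify the plane with the complex numbers and let \<open>a\<^sub>j\<close> be the points that carry a nonzero weight
  \<open>\<alpha>\<^sub>j\<close>. Testing a function \<open>h\<close> with rotations followed by translations gives
  \<open>\<Sum> \<alpha>\<^sub>j h(z + u a\<^sub>j) = 0\<close> for all \<open>z\<close> and all unit complex numbers \<open>u\<close>, and these equations force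
  \<open>h = 0\<close>.

  First the translates of \<open>h\<close> along any unit vector are shown to be linearly dependent, in a way that
  does not depend on \<open>h\<close> or on the vector. Choose a vertex \<open>a\<^sub>0\<close> of the convex hull of the points.
  Given a vector \<open>p\<close> far from the origin, rotate the configuration so that all the other points, seen
  from the vertex placed at \<open>p\<close>, lie towards the origin; the equation then expresses the value of \<open>h\<close>
  at \<open>p\<close> by values at shorter vectors. Finitely many rotations by
  \<^emph>\<open>Gaussian rational\<close> unit numbers serve all directions, because these numbers are dense in the unit
  circle. As the points are rational too, the whole process stays in one lattice \<open>\<int>[\<i>]/N\<close> and so ends
  in a finite ball (\<open>lattice_reduction\<close>). The values at all multiples of a unit vector \<open>v\<close> are thus
  combinations of finitely many values, and linear algebra yields one polynomial \<open>Q \<noteq> 0\<close> such that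
  \<open>Q\<close> of the translation by \<open>v\<close> kills \<open>h\<close>, for every unit vector \<open>v\<close> (\<open>universal_recurrence\<close>).

  Suppose now that \<open>h \<noteq> 0\<close>. As \<open>Q\<close> splits into linear factors, \<open>h\<close> can be replaced by a nonzero
  solution that is an eigenfunction of any finitely many prescribed unit translations, with
  eigenvalues among the roots of \<open>Q\<close> (\<open>simultaneous_shift_eigenfunction\<close>). Every vector of length at
  most \<open>2\<close> is a sum of two unit vectors, so short translations have eigenvalues in the finite set \<open>F\<close>
  of products of two roots. If \<open>y\<close> is so short that \<open>i y\<close> is short for \<open>i \<le> |F|\<close>, then the eigenvalue \<open>c\<close> of \<open>y\<close>
  has the powers \<open>c\<^sup>i \<in> F\<close>, hence is a root of unity of order dividing \<open>|F|!\<close>. Writing each \<open>a\<^sub>j\<close> as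
  a multiple of \<open>|F|! y\<close> with \<open>y\<close> short shows that the eigenfunction has period \<open>a\<^sub>j\<close>. The equation
  therefore reads \<open>(\<Sum> \<alpha>\<^sub>j) h = 0\<close>, which contradicts \<open>\<Sum> \<alpha>\<^sub>j \<noteq> 0\<close> (\<open>annihilated_trivial\<close>).
\<close>

section \<open>Extreme points and rational rotations\<close>

text \<open>
  A point \<open>a\<^sub>j\<close> of maximal modulus works with \<open>d = a\<^sub>j/|a\<^sub>j|\<close>, since the other points lie in the disc
  of radius \<open>|a\<^sub>j|\<close>, which is strictly convex; if \<open>a\<^sub>j = 0\<close>, it is the only point. The bound is uniform because \<open>J\<close> is
  finite.\<close>
lemma extreme_point_direction:
  fixes a :: "nat \<Rightarrow> complex"
  assumes "finite J" "J \<noteq> {}" "inj_on a J"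
  obtains j d c where "j \<in> J" "cmod d = 1" "c > 0"
    "\<And>k. k \<in> J - {j} \<Longrightarrow> Re ((a k - a j) * cnj d) \<le> - c"
proof -
  obtain j where j: "j \<in> J" "\<And>k. k \<in> J \<Longrightarrow> cmod (a k) \<le> cmod (a j)"
  proof -
    have "Max ((\<lambda>k. cmod (a k)) ` J) \<in> (\<lambda>k. cmod (a k)) ` J"
      using assms by (intro Max_in) auto
    then obtain j where "j \<in> J" "Max ((\<lambda>k. cmod (a k)) ` J) = cmod (a j)" by auto
    moreover have "cmod (a k) \<le> Max ((\<lambda>k. cmod (a k)) ` J)" if "k \<in> J" for k
      using assms that by (intro Max_ge) auto
    ultimately show ?thesis using that by auto
  qed
  define d where "d = (if a j = 0 then 1 else sgn (a j))"
  have d: "cmod d = 1" by (auto simp: d_def norm_sgn)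
  have neg: "Re ((a k - a j) * cnj d) < 0" if k: "k \<in> J - {j}" for k
  proof -
    have ne: "a k \<noteq> a j" using k j(1) assms(3) by (auto simp: inj_on_def)
    have le: "cmod (a k) \<le> cmod (a j)" using j(2) k by auto
    have nz: "a j \<noteq> 0" using ne le by auto
    have "(cmod (a k - a j))\<^sup>2 = (cmod (a k))\<^sup>2 - (cmod (a j))\<^sup>2 - 2 * Re ((a k - a j) * cnj (a j))"
      unfolding cmod_power2 by (simp add: power2_eq_square algebra_simps)
    moreover have "(cmod (a k - a j))\<^sup>2 > 0" using ne by simp
    moreover have "(cmod (a k))\<^sup>2 \<le> (cmod (a j))\<^sup>2" using le by simp
    ultimately have "Re ((a k - a j) * cnj (a j)) < 0" by linarith
    moreover have "Re ((a k - a j) * cnj d) = Re ((a k - a j) * cnj (a j)) / cmod (a j)"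
      using nz by (simp add: d_def sgn_eq add_divide_distrib)
    ultimately show ?thesis using nz by (simp add: divide_neg_pos)
  qed
  \<comment> \<open>The element \<open>1\<close> only guards against the empty minimum when \<open>J = {j}\<close>.\<close>
  define c where "c = Min (insert 1 ((\<lambda>k. - Re ((a k - a j) * cnj d)) ` (J - {j})))"
  have "0 < x" if "x \<in> insert 1 ((\<lambda>k. - Re ((a k - a j) * cnj d)) ` (J - {j}))" for x
  proof -
    from that consider "x = 1" | k where "k \<in> J - {j}" "x = - Re ((a k - a j) * cnj d)" by blast
    then show ?thesis
    proof cases
      case 2
      then show ?thesis using neg[OF 2(1)] by linarith
    qed simp
  qed
  then have "c > 0" unfolding c_def using assms(1) by (subst Min_gr_iff) blast+
  moreover have "Re ((a k - a j) * cnj d) \<le> - c" if "k \<in> J - {j}" for k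
  proof -
    have "c \<le> - Re ((a k - a j) * cnj d)"
      unfolding c_def using assms(1) that by (intro Min_le) auto
    then show ?thesis by simp
  qed
  ultimately show ?thesis using that j(1) d by blast
qed

definition gaussian_rationals :: "complex set" where
  "gaussian_rationals = {x. Re x \<in> \<rat> \<and> Im x \<in> \<rat>}"

lemma gaussian_rationals_mult:
  "x \<in> gaussian_rationals \<Longrightarrow> y \<in> gaussian_rationals \<Longrightarrow> x * y \<in> gaussian_rationals"
  by (simp add: gaussian_rationals_def)

lemma gaussian_rationals_diff:
  "x \<in> gaussian_rationals \<Longrightarrow> y \<in> gaussian_rationals \<Longrightarrow> x - y \<in> gaussian_rationals"
  by (simp add: gaussian_rationals_def)

text \<open>
  Stereographic projection from \<open>-1\<close> parametrises the rest of the circle by the real line, and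
  rational parameters give rational points.\<close>
lemma rational_unit_near:
  assumes w: "cmod w = 1" and e: "e > 0"
  shows "\<exists>u\<in>gaussian_rationals. cmod u = 1 \<and> dist u w < e"
proof (cases "w = -1")
  case True
  then show ?thesis using e by (intro bexI[of _ "-1"]) (auto simp: gaussian_rationals_def)
next
  case False
  define r where "r t = Complex ((1 - t\<^sup>2) / (1 + t\<^sup>2)) (2 * t / (1 + t\<^sup>2))" for t :: real
  have pos: "1 + t\<^sup>2 > 0" for t :: real by (smt (verit) zero_le_power2)
  have r_unit: "cmod (r t) = 1" for t
  proof -
    have "(1 - t\<^sup>2)\<^sup>2 + (2 * t)\<^sup>2 = (1 + t\<^sup>2)\<^sup>2" by (simp add: power2_eq_square algebra_simps)
    then have "((1 - t\<^sup>2) / (1 + t\<^sup>2))\<^sup>2 + (2 * t / (1 + t\<^sup>2))\<^sup>2 = 1"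
      using pos[of t] by (simp add: power_divide add_divide_distrib[symmetric])
    then show ?thesis by (simp add: r_def cmod_def)
  qed
  have w2: "(Re w)\<^sup>2 + (Im w)\<^sup>2 = 1" using w by (metis cmod_power2 one_power2)
  have ne: "1 + Re w \<noteq> 0"
  proof
    assume "1 + Re w = 0"
    then have re: "Re w = -1" by simp
    then have "Im w = 0" using w2 by simp
    with re False show False by (simp add: complex_eq_iff)
  qed
  define t where "t = Im w / (1 + Re w)"
  have "r t = w"
  proof -
    have "(1 + Re w)\<^sup>2 + (Im w)\<^sup>2 = 2 * (1 + Re w)"
      using w2 by (simp add: power2_eq_square algebra_simps)
    moreover have "1 + t\<^sup>2 = ((1 + Re w)\<^sup>2 + (Im w)\<^sup>2) / (1 + Re w)\<^sup>2"
      using ne by (simp add: t_def power_divide add_divide_distrib)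
    moreover have "2 * x / x\<^sup>2 = 2 / x" for x :: real by (simp add: power2_eq_square)
    ultimately have t2: "1 + t\<^sup>2 = 2 / (1 + Re w)"
      by metis
    then have "1 - t\<^sup>2 = 2 - 2 / (1 + Re w)" by simp
    then have "(1 - t\<^sup>2) / (1 + t\<^sup>2) = Re w" unfolding t2 using ne by (simp add: field_simps)
    moreover have "2 * t / (1 + t\<^sup>2) = Im w" unfolding t2 using ne by (simp add: t_def)
    ultimately show ?thesis by (simp add: r_def complex_eq_iff)
  qed
  moreover have "isCont r t"
    unfolding r_def Complex_eq using pos[of t] by (intro continuous_intros) auto
  ultimately obtain \<delta> where \<delta>: "\<delta> > 0" "\<And>s. dist s t < \<delta> \<Longrightarrow> dist (r s) w < e"
    using e unfolding continuous_at_eps_delta by metis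
  obtain s where s: "s \<in> \<rat>" "t < s" "s < t + \<delta>" using Rats_dense_in_real[of t "t + \<delta>"] \<delta>(1) by auto
  have "r s \<in> gaussian_rationals" using s(1) by (simp add: r_def gaussian_rationals_def)
  moreover have "dist (r s) w < e" using s by (intro \<delta>(2)) (auto simp: dist_real_def)
  ultimately show ?thesis using r_unit by blast
qed

text \<open>By density and compactness of the circle.\<close>
lemma finite_rational_unit_net:
  assumes "e > 0"
  obtains U where "finite U" "U \<subseteq> gaussian_rationals" "\<And>u. u \<in> U \<Longrightarrow> cmod u = 1"
    "\<And>w. cmod w = 1 \<Longrightarrow> \<exists>u\<in>U. cmod (u - w) < e"
proof -
  let ?V = "{u \<in> gaussian_rationals. cmod u = 1}"
  have "sphere 0 1 \<subseteq> (\<Union>u\<in>?V. ball u e)"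
    using rational_unit_near[OF _ assms] by fastforce
  then obtain U where U: "U \<subseteq> ?V" "finite U" "sphere 0 1 \<subseteq> (\<Union>u\<in>U. ball u e)"
    using compactE_image[of "sphere (0::complex) 1" ?V "\<lambda>u. ball u e"] by (metis compact_sphere open_ball)
  show ?thesis
  proof (rule that[OF U(2)])
    show "\<exists>u\<in>U. cmod (u - w) < e" if "cmod w = 1" for w
      using U(3) that by (force simp: dist_norm)
  qed (use U in auto)
qed

lemma finite_common_denominator:
  assumes "finite X" "X \<subseteq> gaussian_rationals"
  obtains N :: nat where "N > 0" "\<And>x. x \<in> X \<Longrightarrow> \<exists>m n :: int. of_nat N * x = Complex (of_int m) (of_int n)"
  using assms
proof (induction arbitrary: thesis rule: finite_induct)
  case empty
  then show ?case by (metis empty_iff zero_less_one)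
next
  case (insert x X)
  obtain N where N: "N > 0" "\<And>x. x \<in> X \<Longrightarrow> \<exists>m n :: int. of_nat N * x = Complex (of_int m) (of_int n)"
    using insert.IH insert.prems(2) by auto
  obtain p q where pq: "q > 0" "Re x = of_int p / of_int q"
    using insert.prems(2) by (auto simp: gaussian_rationals_def elim!: Rats_cases')
  obtain r s where rs: "s > 0" "Im x = of_int r / of_int s"
    using insert.prems(2) by (auto simp: gaussian_rationals_def elim!: Rats_cases')
  have q: "real (nat q) = of_int q" "real (nat s) = of_int s" using pq rs by simp_all
  show ?case
  proof (rule insert.prems(1)[of "N * nat q * nat s"])
    fix y assume y: "y \<in> insert x X"
    show "\<exists>m n :: int. of_nat (N * nat q * nat s) * y = Complex (of_int m) (of_int n)"
    proof (cases "y = x")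
      case True
      have "of_nat (N * nat q * nat s) * x = Complex (of_int (int N * s * p)) (of_int (int N * q * r))"
        using pq rs q by (simp add: complex_eq_iff)
      with True show ?thesis by blast
    next
      case False
      then obtain m n :: int where "of_nat N * y = Complex (of_int m) (of_int n)" using N(2)[of y] y by blast
      then have "of_nat (N * nat q * nat s) * y = Complex (of_int (q * s * m)) (of_int (q * s * n))"
        using pq rs q by (simp add: complex_eq_iff algebra_simps)
      then show ?thesis by blast
    qed
  qed (use N pq rs in auto)
qed

section \<open>A recurrence shared by all unit translations\<close>

definition annihilated :: "nat set \<Rightarrow> (nat \<Rightarrow> complex) \<Rightarrow> (nat \<Rightarrow> complex) \<Rightarrow> (complex \<Rightarrow> complex) set" where
  "annihilated J \<alpha> a = {h. \<forall>z u. cmod u = 1 \<longrightarrow> (\<Sum>j\<in>J. \<alpha> j * h (z + u * a j)) = 0}"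

text \<open>
  Well-founded descent in the lattice of Gaussian integers divided by \<open>N\<close>: outside the disc of radius
  \<open>R\<close> a suitably rotated copy of the configuration, with its vertex at \<open>p\<close>, expresses the value at \<open>p\<close>
  by values at shorter lattice vectors. The coefficients depend neither on \<open>h\<close> nor on the base point
  \<open>z\<close>, nor on the unit vector \<open>v\<close> along which the lattice is laid out; this uniformity
  is what later gives a single polynomial for all unit vectors.\<close>
lemma lattice_reduction:
  fixes a \<alpha> :: "nat \<Rightarrow> complex"
  assumes "finite J" "J \<noteq> {}" "inj_on a J" "a ` J \<subseteq> gaussian_rationals"
    and "\<forall>j\<in>J. \<alpha> j \<noteq> 0"
  shows "\<exists>B. finite B \<and> (\<forall>n::nat. \<exists>c. \<forall>h\<in>annihilated J \<alpha> a. \<forall>z v. cmod v = 1 \<longrightarrow>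
      h (z + of_nat n * v) = (\<Sum>q\<in>B. c q * h (z + q * v)))"
proof -
  obtain j d \<delta> where j: "j \<in> J" and d: "cmod d = 1" and \<delta>: "\<delta> > 0"
    and neg: "\<And>k. k \<in> J - {j} \<Longrightarrow> Re ((a k - a j) * cnj d) \<le> - \<delta>"
    using extreme_point_direction[OF assms(1-3)] by metis
  define b where "b k = a k - a j" for k
  define D where "D = 1 + (\<Sum>k\<in>J. cmod (b k))"
  have D: "D > 0" by (auto simp: D_def intro!: add_pos_nonneg sum_nonneg)
  have bD: "cmod (b k) \<le> D" if "k \<in> J" for k
    using member_le_sum[of k J "\<lambda>k. cmod (b k)"] that assms(1) by (simp add: D_def)
  obtain U where U: "finite U" "U \<subseteq> gaussian_rationals" "\<And>u. u \<in> U \<Longrightarrow> cmod u = 1"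
    and net: "\<And>w. cmod w = 1 \<Longrightarrow> \<exists>u\<in>U. cmod (u - w) < \<delta> / (2 * D)"
    using finite_rational_unit_net[of "\<delta> / (2 * D)"] \<delta> D by auto
  have "finite ((\<lambda>(u, k). u * b k) ` (U \<times> J))" using U assms by auto
  moreover have "(\<lambda>(u, k). u * b k) ` (U \<times> J) \<subseteq> gaussian_rationals"
    using U(2) assms(4) j by (auto simp: b_def intro!: gaussian_rationals_mult gaussian_rationals_diff)
  ultimately obtain N :: nat where N: "N > 0" and
    Nub: "\<And>x. x \<in> (\<lambda>(u, k). u * b k) ` (U \<times> J) \<Longrightarrow> \<exists>m n :: int. of_nat N * x = Complex (of_int m) (of_int n)"
    using finite_common_denominator[of "(\<lambda>(u, k). u * b k) ` (U \<times> J)"] by blast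
  define pt :: "int \<Rightarrow> int \<Rightarrow> complex" where "pt m n = Complex (of_int m) (of_int n) / of_nat N" for m n
  have cmod_pt: "(cmod (pt m n))\<^sup>2 = real (nat (m\<^sup>2 + n\<^sup>2)) / (real N)\<^sup>2" for m n
    by (simp add: pt_def norm_divide power_divide cmod_power2)
  \<comment> \<open>Rotating by an element of \<open>U\<close> costs at most half of the margin \<open>\<delta>\<close>, so moving from \<open>p\<close> by
    a rotated difference changes \<open>|p|\<^sup>2\<close> by at most \<open>D\<^sup>2 - |p| \<delta>\<close>, which is negative beyond \<open>R\<close>.\<close>
  define R where "R = D\<^sup>2 / \<delta>"
  define K where "K = \<lceil>R * N\<rceil>"
  define B where "B = (\<lambda>(m, n). pt m n) ` ({-K..K} \<times> {-K..K})"
  have finB: "finite B" by (simp add: B_def)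
  have inB: "pt m n \<in> B" if le: "cmod (pt m n) \<le> R" for m n
  proof -
    have "\<bar>Re (pt m n)\<bar> \<le> R" "\<bar>Im (pt m n)\<bar> \<le> R"
      using le abs_Re_le_cmod[of "pt m n"] abs_Im_le_cmod[of "pt m n"] by linarith+
    then have "\<bar>real_of_int m\<bar> \<le> R * N" "\<bar>real_of_int n\<bar> \<le> R * N"
      using N by (simp_all add: pt_def field_simps)
    then have "m \<in> {-K..K}" "n \<in> {-K..K}" unfolding K_def by (auto simp: abs_le_iff) linarith+
    then show ?thesis by (auto simp: B_def)
  qed
  let ?good = "\<lambda>p c. \<forall>h\<in>annihilated J \<alpha> a. \<forall>z v. cmod v = 1 \<longrightarrow>
      h (z + p * v) = (\<Sum>q\<in>B. c q * h (z + q * v))"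
  have red: "\<exists>c. ?good (pt m n) c" for m n
  proof (induction "nat (m\<^sup>2 + n\<^sup>2)" arbitrary: m n rule: less_induct)
    case less
    let ?p = "pt m n"
    show ?case
    proof (cases "cmod ?p \<le> R")
      case True
      then have "(\<Sum>q\<in>B. (if q = ?p then 1 else 0) * h (z + q * v)) = h (z + ?p * v)"
        for h :: "complex \<Rightarrow> complex" and z v
        using inB[OF True] finB by (subst sum.remove[of B ?p]) auto
      then show ?thesis by (intro exI[of _ "\<lambda>q. if q = ?p then 1 else 0"]) simp
    next
      case False
      have "R > 0" using \<delta> D by (simp add: R_def)
      with False have pR: "cmod ?p > R" and p0: "cmod ?p > 0" "?p \<noteq> 0" by auto
      \<comment> \<open>The rotation that turns \<open>d\<close> exactly into the direction of \<open>p\<close>.\<close>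
      define w where "w = sgn ?p * cnj d"
      have w: "cmod w = 1" using p0 d by (simp add: w_def norm_mult norm_sgn)
      have "cnj d * d = 1" using d by (metis complex_norm_square mult.commute of_real_1 one_power2)
      then have p_eq: "?p = cmod ?p * (w * d)" using p0 by (simp add: w_def sgn_eq mult.assoc)
      obtain u where u: "u \<in> U" "cmod (u - w) < \<delta> / (2 * D)" using net w by blast
      have shorter: "cmod (?p + u * b k) < cmod ?p" if k: "k \<in> J - {j}" for k
      proof -
        have "cnj w * w = 1" using w by (metis complex_norm_square mult.commute of_real_1 one_power2)
        then have eq: "u * b k * cnj (w * d) = b k * cnj d + (u - w) * cnj w * (b k * cnj d)"
          by (simp add: algebra_simps)
        have "cmod ((u - w) * cnj w * (b k * cnj d)) = cmod (u - w) * cmod (b k)"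
          using w d by (simp add: norm_mult)
        also have "\<dots> \<le> \<delta> / (2 * D) * D" using u(2) bD[of k] k \<delta> D by (intro mult_mono) auto
        also have "\<dots> = \<delta> / 2" using D by simp
        finally have "Re ((u - w) * cnj w * (b k * cnj d)) \<le> \<delta> / 2"
          using complex_Re_le_cmod order_trans by blast
        then have "Re (u * b k * cnj (w * d)) \<le> - (\<delta> / 2)"
          unfolding eq using neg[OF k] by (simp add: b_def)
        then have "cmod ?p * Re (u * b k * cnj (w * d)) \<le> cmod ?p * - (\<delta> / 2)"
          using p0 by (intro mult_left_mono) auto
        moreover have "Re (u * b k * cnj ?p) = cmod ?p * Re (u * b k * cnj (w * d))"
          by (subst (1) p_eq) (simp add: algebra_simps)
        ultimately have 1: "Re (u * b k * cnj ?p) \<le> - (cmod ?p * \<delta> / 2)" by simp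
        have "(cmod (?p + u * b k))\<^sup>2 = (cmod ?p)\<^sup>2 + (cmod (u * b k))\<^sup>2 + 2 * Re (u * b k * cnj ?p)"
          unfolding cmod_power2 by (simp add: power2_eq_square algebra_simps)
        moreover have "(cmod (u * b k))\<^sup>2 \<le> D\<^sup>2"
          using bD[of k] k U(3)[OF u(1)] by (intro power_mono) (auto simp: norm_mult)
        moreover have "D\<^sup>2 < cmod ?p * \<delta>" using pR \<delta> by (simp add: R_def field_simps)
        ultimately have "(cmod (?p + u * b k))\<^sup>2 < (cmod ?p)\<^sup>2" using 1 by linarith
        then show ?thesis by (rule power_less_imp_less_base) simp
      qed
      have "\<exists>c. ?good (?p + u * b k) c" if k: "k \<in> J - {j}" for k
      proof -
        obtain m' n' :: int where "of_nat N * (u * b k) = Complex (of_int m') (of_int n')"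
          using Nub[of "u * b k"] u(1) k by force
        then have "u * b k = pt m' n'" using N by (simp add: pt_def field_simps)
        then have eq: "?p + u * b k = pt (m + m') (n + n')"
          by (simp add: pt_def complex_eq_iff add_divide_distrib)
        have "(cmod (?p + u * b k))\<^sup>2 < (cmod ?p)\<^sup>2" using shorter[OF k] by (intro power_strict_mono) auto
        then have "nat ((m + m')\<^sup>2 + (n + n')\<^sup>2) < nat (m\<^sup>2 + n\<^sup>2)"
          unfolding eq cmod_pt using N by (simp add: divide_less_cancel del: of_nat_nat)
        then show ?thesis unfolding eq by (rule less)
      qed
      then obtain c where c: "\<And>k. k \<in> J - {j} \<Longrightarrow> ?good (?p + u * b k) (c k)" by metis
      define c' where "c' q = - (\<Sum>k\<in>J - {j}. \<alpha> k / \<alpha> j * c k q)" for q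
      have "?good ?p c'"
      proof (intro ballI allI impI)
        fix h z v assume h: "h \<in> annihilated J \<alpha> a" and v: "cmod (v :: complex) = 1"
        have "cmod (v * u) = 1" using v U(3)[OF u(1)] by (simp add: norm_mult)
        \<comment> \<open>The base point places the vertex \<open>a j\<close> of the rotated configuration at \<open>z + p v\<close>.\<close>
        then have "(\<Sum>k\<in>J. \<alpha> k * h (z + ?p * v - v * u * a j + v * u * a k)) = 0"
          using h unfolding annihilated_def by blast
        moreover have "z + ?p * v - v * u * a j + v * u * a k = z + (?p + u * b k) * v" for k
          by (simp add: b_def algebra_simps)
        ultimately have "(\<Sum>k\<in>J. \<alpha> k * h (z + (?p + u * b k) * v)) = 0" by simp
        then have "\<alpha> j * h (z + ?p * v) + (\<Sum>k\<in>J - {j}. \<alpha> k * h (z + (?p + u * b k) * v)) = 0"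
          using j assms(1) by (simp add: sum.remove b_def)
        then have "h (z + ?p * v) = - (\<Sum>k\<in>J - {j}. \<alpha> k * h (z + (?p + u * b k) * v)) / \<alpha> j"
          using assms(5) j by (simp add: field_simps eq_neg_iff_add_eq_0)
        also have "\<dots> = - (\<Sum>k\<in>J - {j}. \<alpha> k / \<alpha> j * (\<Sum>q\<in>B. c k q * h (z + q * v)))"
          using c h v by (simp add: sum_divide_distrib)
        also have "\<dots> = (\<Sum>q\<in>B. c' q * h (z + q * v))"
          by (simp add: c'_def sum_distrib_left sum_distrib_right sum_negf mult.assoc) (rule sum.swap)
        finally show "h (z + ?p * v) = (\<Sum>q\<in>B. c' q * h (z + q * v))" .
      qed
      then show ?thesis by (rule exI[of _ c'])
    qed
  qed
  have "\<exists>c. ?good (of_nat n) c" for n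
  proof -
    have "of_nat n = pt (int (n * N)) 0" using N by (simp add: pt_def complex_eq_iff)
    with red[of "int (n * N)" 0] show ?thesis by (simp only:)
  qed
  then have "\<forall>n::nat. \<exists>c. ?good (of_nat n) c" by (rule allI)
  with finB have "finite B \<and> (\<forall>n::nat. \<exists>c. ?good (of_nat n) c)" by (rule conjI)
  then show ?thesis by (rule exI[of _ B])
qed

text \<open>The polynomial \<open>Q\<close> evaluated at the operator of translation by \<open>v\<close>, applied to \<open>h\<close>.\<close>
definition poly_shift :: "complex poly \<Rightarrow> complex \<Rightarrow> (complex \<Rightarrow> complex) \<Rightarrow> complex \<Rightarrow> complex" where
  "poly_shift Q v h z = (\<Sum>n\<le>degree Q. coeff Q n * h (z + of_nat n * v))"

lemma poly_shift_upto:
  "degree Q \<le> m \<Longrightarrow> poly_shift Q v h z = (\<Sum>n\<le>m. coeff Q n * h (z + of_nat n * v))"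
  unfolding poly_shift_def by (intro sum.mono_neutral_left) (auto simp: coeff_eq_0)

lemma poly_shift_linear_factor:
  "poly_shift ([:- c, 1:] * Q) v h z = poly_shift Q v h (z + v) - c * poly_shift Q v h z"
proof -
  define m where "m = Suc (degree Q)"
  have eq: "[:- c, 1:] * Q = pCons 0 Q - smult c Q" by (simp add: mult_pCons_left)
  have deg: "degree (pCons 0 Q - smult c Q) \<le> m"
    unfolding m_def by (intro degree_diff_le) (auto intro: degree_pCons_le le_trans[OF degree_smult_le])
  have "poly_shift ([:- c, 1:] * Q) v h z
      = (\<Sum>n\<le>m. coeff (pCons 0 Q) n * h (z + of_nat n * v)) - c * (\<Sum>n\<le>m. coeff Q n * h (z + of_nat n * v))"
    unfolding eq poly_shift_upto[OF deg] by (simp add: algebra_simps sum_subtractf sum_distrib_left)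
  also have "(\<Sum>n\<le>m. coeff (pCons 0 Q) n * h (z + of_nat n * v)) = poly_shift Q v h (z + v)"
    unfolding m_def poly_shift_def by (simp add: sum.atMost_Suc_shift algebra_simps del: sum.atMost_Suc)
  also have "(\<Sum>n\<le>m. coeff Q n * h (z + of_nat n * v)) = poly_shift Q v h z"
    by (rule poly_shift_upto[symmetric]) (simp add: m_def)
  finally show ?thesis .
qed

text \<open>
  Gaussian elimination on the vectors \<open>c n\<close>: one of them with a nonzero \<open>b\<close>-coordinate clears that
  coordinate from all the others.\<close>
lemma linear_dependence:
  fixes c :: "'a \<Rightarrow> 'b \<Rightarrow> complex"
  assumes "finite B" "finite S" "card B < card S"
  shows "\<exists>q. (\<exists>n\<in>S. q n \<noteq> 0) \<and> (\<forall>b\<in>B. (\<Sum>n\<in>S. q n * c n b) = 0)"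
  using assms
proof (induction B arbitrary: S c rule: finite_induct)
  case empty
  then show ?case by (intro exI[of _ "\<lambda>_. 1"]) (auto simp: card_gt_0_iff)
next
  case (insert b B)
  show ?case
  proof (cases "\<forall>n\<in>S. c n b = 0")
    case True
    then show ?thesis using insert.IH[of S c] insert.prems insert.hyps by auto
  next
    case False
    then obtain m where m: "m \<in> S" "c m b \<noteq> 0" by auto
    define c' where "c' n x = c n x - c n b / c m b * c m x" for n x
    have "card B < card (S - {m})" using insert.prems insert.hyps m by simp
    then obtain q where q: "\<exists>n\<in>S - {m}. q n \<noteq> 0" "\<forall>x\<in>B. (\<Sum>n\<in>S - {m}. q n * c' n x) = 0"
      using insert.IH[of "S - {m}" c'] insert.prems by auto
    define q' where "q' = q(m := - (\<Sum>n\<in>S - {m}. q n * c n b / c m b))"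
    have eq: "(\<Sum>n\<in>S. q' n * c n x) = (\<Sum>n\<in>S - {m}. q n * c' n x)" for x
    proof -
      have "(\<Sum>n\<in>S. q' n * c n x) = q' m * c m x + (\<Sum>n\<in>S - {m}. q' n * c n x)"
        using insert.prems m by (simp add: sum.remove)
      also have "(\<Sum>n\<in>S - {m}. q' n * c n x) = (\<Sum>n\<in>S - {m}. q n * c n x)"
        by (intro sum.cong) (auto simp: q'_def)
      also have "q' m * c m x = - (\<Sum>n\<in>S - {m}. q n * c n b / c m b * c m x)"
        by (simp add: q'_def sum_distrib_right)
      finally show ?thesis by (simp add: c'_def algebra_simps sum_subtractf)
    qed
    have "c' n b = 0" for n using m by (simp add: c'_def)
    then have "(\<Sum>n\<in>S. q' n * c n x) = 0" if "x \<in> insert b B" for x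
      using that q(2) eq by auto
    moreover have "\<exists>n\<in>S. q' n \<noteq> 0" using q(1) by (auto simp: q'_def)
    ultimately show ?thesis by blast
  qed
qed

text \<open>
  By \<open>lattice_reduction\<close> the values of \<open>h\<close> at \<open>z + n v\<close> for \<open>n \<le> |B|\<close> are combinations of the same
  \<open>|B|\<close> values, so one relation between the coefficient vectors holds for every \<open>h\<close>, \<open>z\<close> and \<open>v\<close>.\<close>
lemma universal_recurrence:
  fixes a \<alpha> :: "nat \<Rightarrow> complex"
  assumes "finite J" "J \<noteq> {}" "inj_on a J" "a ` J \<subseteq> gaussian_rationals"
    and "\<forall>j\<in>J. \<alpha> j \<noteq> 0"
  shows "\<exists>Q. Q \<noteq> 0 \<and> (\<forall>h\<in>annihilated J \<alpha> a. \<forall>v z. cmod v = 1 \<longrightarrow> poly_shift Q v h z = 0)"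
proof -
  obtain B where B: "finite B"
    "\<forall>n::nat. \<exists>c. \<forall>h\<in>annihilated J \<alpha> a. \<forall>z v. cmod v = 1 \<longrightarrow>
      h (z + of_nat n * v) = (\<Sum>q\<in>B. c q * h (z + q * v))"
    using lattice_reduction[OF assms] by (elim exE conjE) (rule that)
  from choice[OF B(2)] obtain c where "\<forall>n::nat. \<forall>h\<in>annihilated J \<alpha> a. \<forall>z v. cmod v = 1 \<longrightarrow>
      h (z + of_nat n * v) = (\<Sum>q\<in>B. c n q * h (z + q * v))" by (elim exE) (rule that)
  then have c: "h (z + of_nat n * v) = (\<Sum>q\<in>B. c n q * h (z + q * v))"
    if "h \<in> annihilated J \<alpha> a" "cmod v = 1" for n h z v
    using that by blast
  obtain x where x: "\<exists>n\<in>{..card B}. x n \<noteq> 0" "\<forall>q\<in>B. (\<Sum>n\<in>{..card B}. x n * c n q) = 0"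
    using linear_dependence[of B "{..card B}" c] B(1) by auto
  define Q where "Q = Abs_poly (\<lambda>n. if n \<le> card B then x n else 0)"
  have coeff: "coeff Q n = (if n \<le> card B then x n else 0)" for n
    unfolding Q_def by (subst Abs_poly_inverse) (auto simp: MOST_nat intro!: exI[of _ "card B"])
  have "degree Q \<le> card B" by (intro degree_le) (auto simp: coeff)
  then have ps: "poly_shift Q v h z = (\<Sum>n\<le>card B. x n * h (z + of_nat n * v))" for v h z
    by (subst poly_shift_upto) (auto simp: coeff)
  show ?thesis
  proof (intro exI[of _ Q] conjI ballI allI impI)
    show "Q \<noteq> 0" using x(1) coeff by (metis atMost_iff coeff_0)
    fix h v z assume h: "h \<in> annihilated J \<alpha> a" "cmod v = 1"
    have "poly_shift Q v h z = (\<Sum>n\<le>card B. \<Sum>q\<in>B. x n * c n q * h (z + q * v))"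
      unfolding ps by (simp add: c[OF h] sum_distrib_left mult.assoc)
    also have "\<dots> = (\<Sum>q\<in>B. (\<Sum>n\<le>card B. x n * c n q) * h (z + q * v))"
      by (subst sum.swap) (simp add: sum_distrib_right)
    also have "\<dots> = 0" using x(2) by simp
    finally show "poly_shift Q v h z = 0" .
  qed
qed

section \<open>Simultaneous eigenfunctions of translations\<close>

text \<open>
  Closure under \<open>g - c h\<close> makes a nonempty set a linear subspace and is the exact form in which the
  operators \<open>T - c\<close> are applied.\<close>
definition shift_invariant_space :: "(complex \<Rightarrow> complex) set \<Rightarrow> bool" where
  "shift_invariant_space L \<longleftrightarrow> (\<forall>h\<in>L. \<forall>w. (\<lambda>z. h (z + w)) \<in> L) \<and>
     (\<forall>g\<in>L. \<forall>h\<in>L. \<forall>c. (\<lambda>z. g z - c * h z) \<in> L)"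

lemma shift_invariant_annihilated: "shift_invariant_space (annihilated J \<alpha> a)"
  unfolding shift_invariant_space_def
proof (intro conjI ballI allI)
  fix h x assume "h \<in> annihilated J \<alpha> a"
  then have "(\<Sum>j\<in>J. \<alpha> j * h (z + x + u * a j)) = 0" if "cmod u = 1" for u z
    using that by (simp add: annihilated_def)
  moreover have "z + x + u * a j = z + u * a j + x" for u z j by simp
  ultimately show "(\<lambda>z. h (z + x)) \<in> annihilated J \<alpha> a"
    by (simp only: annihilated_def mem_Collect_eq) blast
next
  fix g h c assume "g \<in> annihilated J \<alpha> a" "h \<in> annihilated J \<alpha> a"
  then have *: "(\<Sum>j\<in>J. \<alpha> j * g (z + u * a j)) = 0" "(\<Sum>j\<in>J. \<alpha> j * h (z + u * a j)) = 0"
    if "cmod u = 1" for u z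
    using that by (simp_all add: annihilated_def)
  have "(\<Sum>j\<in>J. \<alpha> j * (g (z + u * a j) - c * h (z + u * a j)))
      = (\<Sum>j\<in>J. \<alpha> j * g (z + u * a j)) - c * (\<Sum>j\<in>J. \<alpha> j * h (z + u * a j))" for u z
    by (simp add: algebra_simps sum_subtractf sum_distrib_left)
  then show "(\<lambda>z. g z - c * h z) \<in> annihilated J \<alpha> a"
    using * by (simp add: annihilated_def)
qed

text \<open>
  Apply the linear factors \<open>T - c\<close> of \<open>Q(T)\<close> to \<open>h\<close> one after the other. As the product kills \<open>h\<close>,
  some factor turns a nonzero function into zero, and that function is an eigenfunction.\<close>
lemma shift_eigenfunction:
  assumes L: "shift_invariant_space L" and h: "h \<in> L" "h \<noteq> (\<lambda>_. 0)"
    and Q: "Q \<noteq> 0" "\<And>z. poly_shift Q v h z = 0"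
  shows "\<exists>c g. poly Q c = 0 \<and> g \<in> L \<and> g \<noteq> (\<lambda>_. 0) \<and> (\<forall>z. g (z + v) = c * g z)"
  using h Q
proof (induction "degree Q" arbitrary: Q h)
  case 0
  then have "coeff Q 0 \<noteq> 0" by (metis leading_coeff_0_iff)
  with 0 have "h = (\<lambda>_. 0)" by (auto simp: poly_shift_def fun_eq_iff)
  with 0 show ?case by simp
next
  case (Suc n)
  have "\<not> constant (poly Q)" using Suc.hyps(2) by (simp add: constant_degree)
  then obtain c where c: "poly Q c = 0" using fundamental_theorem_of_algebra by blast
  then obtain P where P: "Q = [:- c, 1:] * P" by (auto simp: poly_eq_0_iff_dvd)
  have P0: "P \<noteq> 0" using P Suc.prems by auto
  have deg: "degree P = n" using Suc.hyps(2) P0 unfolding P by (subst (asm) degree_mult_eq) auto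
  define g where "g z = h (z + v) - c * h z" for z
  show ?case
  proof (cases "g = (\<lambda>_. 0)")
    case True
    then have "\<forall>z. h (z + v) = c * h z" by (simp add: g_def fun_eq_iff)
    with c Suc.prems(1,2) show ?thesis by (intro exI[of _ c] exI[of _ h] conjI)
  next
    case False
    have sub: "(\<lambda>z. g z - e * h z) \<in> L" if "g \<in> L" "h \<in> L" for g h e
      using L that by (simp add: shift_invariant_space_def)
    have "(\<lambda>z. h (z + v)) \<in> L" using L Suc.prems(1) by (simp add: shift_invariant_space_def)
    from sub[OF this Suc.prems(1)] have "g \<in> L" by (simp add: g_def[abs_def])
    have "poly_shift P v g z = 0" for z
    proof -
      have "poly_shift P v g z = poly_shift Q v h z"
        unfolding P poly_shift_linear_factor
        by (simp add: poly_shift_def g_def algebra_simps sum_subtractf sum_distrib_left)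
      then show ?thesis using Suc.prems by simp
    qed
    from Suc.hyps(1)[OF deg[symmetric] \<open>g \<in> L\<close> False P0 this]
    obtain e k where k: "poly P e = 0" "k \<in> L" "k \<noteq> (\<lambda>_. 0)" "\<forall>z. k (z + v) = e * k z"
      by (elim exE conjE) (rule that)
    have "poly Q e = 0" using k(1) by (simp add: P)
    with k(2-4) show ?thesis by (intro exI[of _ e] exI[of _ k] conjI)
  qed
qed

text \<open>
  Translations commute, so an eigenspace of one of them inside \<open>L\<close> is again invariant under
  translations, and the next eigenfunction can be sought inside it.\<close>
lemma simultaneous_shift_eigenfunction:
  assumes L: "shift_invariant_space L" and h: "h \<in> L" "h \<noteq> (\<lambda>_. 0)"
    and Q: "Q \<noteq> 0" "\<And>h v z. h \<in> L \<Longrightarrow> v \<in> S \<Longrightarrow> poly_shift Q v h z = 0"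
    and S: "finite S"
  shows "\<exists>g\<in>L. g \<noteq> (\<lambda>_. 0) \<and> (\<forall>v\<in>S. \<exists>c. poly Q c = 0 \<and> (\<forall>z. g (z + v) = c * g z))"
  using S L h Q(2)
proof (induction S arbitrary: L h rule: finite_induct)
  case empty
  then show ?case by auto
next
  case (insert v S)
  have "poly_shift Q v h z = 0" for z using insert.prems(2,4) by simp
  from shift_eigenfunction[OF insert.prems(1-3) Q(1) this]
  obtain c g where g: "poly Q c = 0" "g \<in> L" "g \<noteq> (\<lambda>_. 0)" "\<forall>z. g (z + v) = c * g z"
    by (elim exE conjE) (rule that)
  define L' where "L' = {k \<in> L. \<forall>z. k (z + v) = c * k z}"
  have L': "shift_invariant_space L'"
    unfolding shift_invariant_space_def
  proof (intro conjI ballI allI)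
    fix k w assume k: "k \<in> L'"
    then have "\<forall>z. k (z + v) = c * k z" by (simp add: L'_def)
    then have "k (z + w + v) = c * k (z + w)" for z by blast
    moreover have "z + w + v = z + v + w" for z by simp
    ultimately have "k (z + v + w) = c * k (z + w)" for z by metis
    then show "(\<lambda>z. k (z + w)) \<in> L'"
      using k insert.prems(1) by (simp add: L'_def shift_invariant_space_def)
  next
    fix k l e assume kl: "k \<in> L'" "l \<in> L'"
    then have "k (z + v) = c * k z" "l (z + v) = c * l z" for z by (simp_all add: L'_def)
    then have "k (z + v) - e * l (z + v) = c * (k z - e * l z)" for z
      by (simp only: right_diff_distrib mult.left_commute)
    moreover have "(\<lambda>z. k z - e * l z) \<in> L"
      using kl insert.prems(1) by (simp add: L'_def shift_invariant_space_def)
    ultimately show "(\<lambda>z. k z - e * l z) \<in> L'" by (simp add: L'_def)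
  qed
  have gL': "g \<in> L'" using g by (simp add: L'_def)
  have kill: "poly_shift Q w k z = 0" if "k \<in> L'" "w \<in> S" for k w z
    by (rule insert.prems(4)) (use that in \<open>simp_all add: L'_def\<close>)
  have "\<exists>k\<in>L'. k \<noteq> (\<lambda>_. 0) \<and> (\<forall>v\<in>S. \<exists>c. poly Q c = 0 \<and> (\<forall>z. k (z + v) = c * k z))"
    by (rule insert.IH[OF L' gL' g(3)]) (rule kill)
  then obtain k where k: "k \<in> L'" "k \<noteq> (\<lambda>_. 0)"
    "\<forall>v\<in>S. \<exists>c. poly Q c = 0 \<and> (\<forall>z. k (z + v) = c * k z)"
    by (elim bexE conjE) (rule that)
  have "k \<in> L" "\<forall>z. k (z + v) = c * k z" using k(1) by (simp_all add: L'_def)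
  with k(3) g(1) have "\<exists>c. poly Q c = 0 \<and> (\<forall>z. k (z + x) = c * k z)" if "x \<in> insert v S" for x
    using that by (cases "x = v") auto
  with \<open>k \<in> L\<close> k(2) show ?case by (intro bexI[of _ k] conjI ballI)
qed

section \<open>Eigenvalues are trivial\<close>

text \<open>The two unit vectors are the sides of the rhombus with diagonal \<open>y\<close>.\<close>
lemma sum_of_two_units:
  assumes "cmod y \<le> 2"
  obtains v w where "cmod v = 1" "cmod w = 1" "y = v + w"
proof -
  define e where "e = (if y = 0 then 1 else sgn y)"
  define s where "s = sqrt (1 - (cmod y / 2)\<^sup>2)"
  have e: "cmod e = 1" by (simp add: e_def norm_sgn)
  have y: "y = cmod y * e" by (simp add: e_def sgn_eq)
  have "(cmod y / 2)\<^sup>2 \<le> 1" using assms by (simp add: power_le_one_iff abs_square_le_1)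
  then have "s\<^sup>2 = 1 - (cmod y / 2)\<^sup>2" by (simp add: s_def)
  then have "cmod (Complex (cmod y / 2) s) = 1" "cmod (Complex (cmod y / 2) (- s)) = 1"
    by (simp_all add: cmod_def)
  moreover have "y = e * Complex (cmod y / 2) s + e * Complex (cmod y / 2) (- s)"
    by (subst (1) y) (simp add: complex_eq_iff algebra_simps)
  ultimately show ?thesis using that e by (metis mult_1 norm_mult)
qed

text \<open>
  Two of the \<open>|F| + 1\<close> powers with exponents \<open>0, \<dots>, |F|\<close> coincide, so the order of \<open>c\<close> is at most
  \<open>|F|\<close>. The factorial gives an exponent that does not depend on \<open>c\<close>.\<close>
lemma finite_pow_values_imp_root_of_unity:
  fixes c :: complex
  assumes "finite F" "c \<noteq> 0" "\<And>i. i \<le> card F \<Longrightarrow> c ^ i \<in> F"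
  shows "c ^ fact (card F) = 1"
proof -
  have "\<not> inj_on (\<lambda>i. c ^ i) {..card F}"
    using card_inj_on_le[of "\<lambda>i. c ^ i" "{..card F}" F] assms by auto
  then obtain i j where ij: "i < j" "j \<le> card F" "c ^ i = c ^ j"
    unfolding inj_on_def by (metis atMost_iff linorder_neqE_nat)
  have "c ^ j = c ^ i * c ^ (j - i)" using ij(1) by (simp flip: power_add)
  then have "c ^ (j - i) = 1" using ij(3) assms(2) by simp
  moreover have "j - i dvd fact (card F)" using ij by (intro dvd_fact) auto
  ultimately show ?thesis by (auto simp: dvd_def power_mult)
qed

text \<open>
  A nonzero solution would give a nonzero solution that is an eigenfunction of the finitely many
  unit translations needed to reach every \<open>i y\<^sub>j\<close>; that one has all the \<open>a\<^sub>j\<close> as periods.\<close>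
lemma annihilated_trivial:
  fixes a \<alpha> :: "nat \<Rightarrow> complex"
  assumes "finite J" "inj_on a J" "a ` J \<subseteq> gaussian_rationals"
    and "\<forall>j\<in>J. \<alpha> j \<noteq> 0" and sum: "(\<Sum>j\<in>J. \<alpha> j) \<noteq> 0"
    and h: "h \<in> annihilated J \<alpha> a"
  shows "h = (\<lambda>_. 0)"
proof (rule ccontr)
  assume h0: "h \<noteq> (\<lambda>_. 0)"
  have "J \<noteq> {}" using sum by auto
  from universal_recurrence[OF assms(1) this assms(2-4)]
  obtain Q where Q: "Q \<noteq> 0"
    "\<forall>h\<in>annihilated J \<alpha> a. \<forall>v z. cmod v = 1 \<longrightarrow> poly_shift Q v h z = 0"
    by (elim exE conjE) (rule that)
  define F where "F = (\<lambda>(x, y). x * y) ` ({c. poly Q c = 0} \<times> {c. poly Q c = 0})"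
  have finF: "finite F" using poly_roots_finite[OF Q(1)] by (simp add: F_def)
  define m where "m = card F"
  \<comment> \<open>Large enough for the multiples \<open>i y\<^sub>j\<close> with \<open>i \<le> m\<close> to have length at most \<open>2\<close>.\<close>
  define K where "K = nat \<lceil>real m * (\<Sum>j\<in>J. cmod (a j))\<rceil> + 1"
  define y where "y j = a j / of_nat (K * fact m)" for j
  have "\<exists>v w. cmod v = 1 \<and> cmod w = 1 \<and> x = v + w" if "cmod x \<le> 2" for x
    using sum_of_two_units[OF that] by metis
  then obtain V W where VW: "\<And>x. cmod x \<le> 2 \<Longrightarrow> cmod (V x) = 1 \<and> cmod (W x) = 1 \<and> x = V x + W x"
    by metis
  define v where "v i j = V (of_nat i * y j)" for i :: nat and j
  define w where "w i j = W (of_nat i * y j)" for i :: nat and j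
  have vw: "cmod (v i j) = 1 \<and> cmod (w i j) = 1 \<and> of_nat i * y j = v i j + w i j"
    if "i \<le> m" "j \<in> J" for i j
  proof -
    have "real i * cmod (a j) \<le> real m * (\<Sum>j\<in>J. cmod (a j))"
      using that assms(1) by (intro mult_mono member_le_sum) (auto intro: sum_nonneg)
    also have "\<dots> \<le> real K" unfolding K_def by linarith
    also have "\<dots> \<le> 2 * real (K * fact m)"
    proof -
      have "(1::nat) \<le> fact m" by (rule fact_ge_1)
      then have "K * 1 \<le> K * fact m" by (rule mult_le_mono2)
      then show ?thesis by linarith
    qed
    finally have "real i * cmod (a j) \<le> 2 * real (K * fact m)" .
    moreover have "real (K * fact m) > 0"
      by (simp only: of_nat_0_less_iff nat_0_less_mult_iff) (simp add: K_def)
    ultimately have "real i * cmod (a j) / real (K * fact m) \<le> 2" by (simp only: divide_le_eq) simp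
    then have "cmod (of_nat i * y j) \<le> 2"
      unfolding y_def norm_mult norm_divide norm_of_nat by simp
    then show ?thesis unfolding v_def w_def by (rule VW)
  qed
  define S where "S = (\<lambda>(i, j). v i j) ` ({..m} \<times> J) \<union> (\<lambda>(i, j). w i j) ` ({..m} \<times> J)"
  have S_unit: "cmod x = 1" if "x \<in> S" for x using that vw by (auto simp: S_def)
  have finS: "finite S" using assms(1) by (simp add: S_def)
  have "\<exists>g\<in>annihilated J \<alpha> a. g \<noteq> (\<lambda>_. 0) \<and>
      (\<forall>x\<in>S. \<exists>c. poly Q c = 0 \<and> (\<forall>z. g (z + x) = c * g z))"
    by (rule simultaneous_shift_eigenfunction[OF shift_invariant_annihilated h h0 Q(1) _ finS]) (simp add: Q(2) S_unit)
  then obtain g where g: "g \<in> annihilated J \<alpha> a" "g \<noteq> (\<lambda>_. 0)"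
    and ev: "\<forall>x\<in>S. \<exists>c. poly Q c = 0 \<and> (\<forall>z. g (z + x) = c * g z)"
    by (elim bexE conjE) (rule that)
  from g(2) obtain z0 where z0: "g z0 \<noteq> 0" by auto
  have period: "g (z + a j) = g z" if j: "j \<in> J" for j z
  proof -
    have "\<exists>c\<in>F. \<forall>z. g (z + of_nat i * y j) = c * g z" if i: "i \<le> m" for i
    proof -
      have "v i j \<in> S" "w i j \<in> S" using i j by (auto simp: S_def)
      then obtain c d where cd: "poly Q c = 0" "\<forall>z. g (z + v i j) = c * g z"
        "poly Q d = 0" "\<forall>z. g (z + w i j) = d * g z" using ev by blast
      have "g (z + of_nat i * y j) = d * c * g z" for z
      proof -
        have "z + of_nat i * y j = (z + v i j) + w i j" using vw[OF i j] by (simp add: add.assoc)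
        then show ?thesis by (simp only: cd(2,4) mult.assoc)
      qed
      moreover have "d * c \<in> F" using cd by (auto simp: F_def)
      ultimately show ?thesis by blast
    qed
    then have "\<forall>i\<in>{..m}. \<exists>c. c \<in> F \<and> (\<forall>z. g (z + of_nat i * y j) = c * g z)" by auto
    from bchoice[OF this] obtain e where
      "\<forall>i\<in>{..m}. e i \<in> F \<and> (\<forall>z. g (z + of_nat i * y j) = e i * g z)" by (elim exE) (rule that)
    then have e: "e i \<in> F" "g (z + of_nat i * y j) = e i * g z" if "i \<le> m" for i z
      using that by auto
    define c where "c = e 1"
    \<comment> \<open>So that the exponent \<open>1\<close> is among those covered by \<open>e\<close>.\<close>
    have "m \<noteq> 0" using e(1)[of 0] finF by (auto simp: m_def)
    then have step: "g (z + y j) = c * g z" for z using e(2)[of 1 z] by (simp add: c_def)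
    have pow: "g (z + of_nat i * y j) = c ^ i * g z" for i z
    proof (induction i arbitrary: z)
      case (Suc i)
      have "z + of_nat (Suc i) * y j = (z + y j) + of_nat i * y j" by (simp add: algebra_simps)
      then show ?case by (simp only: Suc.IH step power_Suc2 mult.assoc)
    qed simp
    have "c ^ i \<in> F" if "i \<le> m" for i
      using pow[of z0 i] e[OF that] z0 by simp
    moreover have "c \<noteq> 0"
      using pow[of "z0 - y j" 1] z0 by auto
    ultimately have "c ^ fact m = 1"
      unfolding m_def by (intro finite_pow_values_imp_root_of_unity finF) auto
    then have pow1: "c ^ (K * fact m) = 1" by (metis mult.commute power_mult power_one)
    have Ky: "of_nat (K * fact m) * y j = a j"
    proof -
      have "K * fact m \<noteq> 0" by (simp add: K_def)
      then have "(of_nat (K * fact m) :: complex) \<noteq> 0" by (simp only: of_nat_eq_0_iff not_False_eq_True)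
      then show ?thesis unfolding y_def by (simp only: times_divide_eq_right nonzero_mult_div_cancel_left not_False_eq_True)
    qed
    from pow[of z "K * fact m"] show ?thesis unfolding Ky pow1 by simp
  qed
  have "\<forall>z u. cmod u = 1 \<longrightarrow> (\<Sum>j\<in>J. \<alpha> j * g (z + u * a j)) = 0"
    using g(1) by (simp only: annihilated_def mem_Collect_eq)
  from this[rule_format, where u = 1 and z = z0] have "(\<Sum>j\<in>J. \<alpha> j * g (z0 + a j)) = 0" by simp
  then have "(\<Sum>j\<in>J. \<alpha> j) * g z0 = 0" by (simp add: period sum_distrib_right)
  with sum z0 show False by simp
qed

section \<open>Finite sets of rational points\<close>

definition vec_of :: "complex \<Rightarrow> real ^ 2" where
  "vec_of z = (\<chi> i. if i = 1 then Re z else Im z)"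

lemma rigid_motion_isometry:
  assumes "cmod u = 1"
  shows "(\<lambda>x. vec_of (z + u * Complex (x $ 1) (x $ 2))) \<in> isometries"
proof -
  define C where "C x = Complex (x $ 1) (x $ 2)" for x :: "real ^ 2"
  have C: "C (vec_of w) = w" for w by (simp add: C_def vec_of_def complex_eq_iff)
  have V: "vec_of (C x) = x" for x by (simp add: C_def vec_of_def vec_eq_iff forall_2)
  have dist_C: "dist (C x) (C y) = dist x y" for x y
    by (simp add: C_def dist_vec_def L2_set_def sum_2 dist_complex_def cmod_def dist_real_def)
  then have dist_V: "dist (vec_of x) (vec_of y) = dist x y" for x y by (metis C)
  have u: "u \<noteq> 0" using assms by auto
  have "bij (\<lambda>x. vec_of (z + u * C x))"
    by (rule o_bij[where g = "\<lambda>x. vec_of ((C x - z) / u)"]) (use u in \<open>auto simp: C V fun_eq_iff\<close>)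
  moreover have "dist (vec_of (z + u * C x)) (vec_of (z + u * C y)) = dist x y" for x y
    unfolding dist_V using assms dist_C[of x y]
    by (simp add: dist_norm norm_mult flip: right_diff_distrib)
  ultimately show ?thesis by (simp add: isometries_def C_def)
qed

lemma finite_rational_set_pompeiu:
  fixes E :: "(real ^ 2) set"
  assumes "finite E" and rat: "\<forall>x\<in>E. \<forall>i. x $ i \<in> \<rat>"
  shows "weighted_pompeiu_set isometries E"
  unfolding weighted_pompeiu_set_def weighted_pompeiu_tuple_def
proof (intro conjI allI impI assms(1))
  fix xs :: "(real ^ 2) list" and \<alpha> :: "nat \<Rightarrow> complex" and f :: "real ^ 2 \<Rightarrow> complex" and x :: "real ^ 2"
  assume xs: "distinct xs \<and> set xs = E" and sum: "(\<Sum>j<length xs. \<alpha> j) \<noteq> 0"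
    and f: "\<forall>\<phi>\<in>isometries. (\<Sum>j<length xs. \<alpha> j * f (\<phi> (xs ! j))) = 0"
  define C where "C x = Complex (x $ 1) (x $ 2)" for x :: "real ^ 2"
  have V: "vec_of (C x) = x" for x by (simp add: C_def vec_of_def vec_eq_iff forall_2)
  \<comment> \<open>Points of weight zero are dropped: the descent divides by the weight of a vertex.\<close>
  define J where "J = {j. j < length xs \<and> \<alpha> j \<noteq> 0}"
  define a where "a j = C (xs ! j)" for j
  have J: "(\<Sum>j\<in>J. \<alpha> j * g j) = (\<Sum>j<length xs. \<alpha> j * g j)" for g
    by (rule sum.mono_neutral_left) (auto simp: J_def)
  have "(\<lambda>z. f (vec_of z)) = (\<lambda>_. 0)"
  proof (rule annihilated_trivial)
    show "finite J" by (simp add: J_def)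
    show "inj_on a J" using xs V unfolding inj_on_def a_def J_def
      by (metis (no_types, lifting) mem_Collect_eq nth_eq_iff_index_eq)
    show "a ` J \<subseteq> gaussian_rationals"
      using xs rat by (auto simp: a_def J_def C_def gaussian_rationals_def)
    show "\<forall>j\<in>J. \<alpha> j \<noteq> 0" by (simp add: J_def)
    show "(\<Sum>j\<in>J. \<alpha> j) \<noteq> 0" using J[of "\<lambda>_. 1"] sum by simp
    show "(\<lambda>z. f (vec_of z)) \<in> annihilated J \<alpha> a"
      using f rigid_motion_isometry by (fastforce simp: annihilated_def J a_def C_def)
  qed
  then have "f (vec_of (C x)) = 0" by metis
  then show "f x = 0" by (simp add: V)
qed

theorem theorem5p2:
  fixes E :: "(real ^ 2) set"
  assumes "card E = 4"
    and "\<forall>x\<in>E. \<forall>i. x $ i \<in> \<rat>"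
  shows "weighted_pompeiu_set isometries E"
proof -
  have "finite E" using assms(1) by (metis card.infinite zero_neq_numeral)
  then show ?thesis using assms(2) by (rule finite_rational_set_pompeiu)
qed

end
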